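(* Let $0<\alpha<1$, let $r\ge 2$ be an integer, and let $M,N\in\mathbb{R}^{n\times n}$ (not assumed to commute). Then the discrete delayed perturbation of the Mittag-Leffler matrix function with $\beta=\alpha$, namely $z(k)=\mathbb{D}_{\alpha,\alpha,r}^{M,N}(k)$, satisfies the homogeneous Riemann-Liouville fractional delayed difference system $$\nabla_{-r}^{\alpha} z(k)=Mz(k)+Nz(k-r)\quad\text{for all } k\in\mathbb{N}_1,$$ $$z(k)=\mathbb{E}_{M,\alpha,\alpha-1}(k,-r)\quad\text{for all } k\in\mathbb{N}_{1-r}^{0}.$$
   Context: Notation: for real $a,b$ with $b-a$ a positive integer, $\mathbb{N}_a=\{a,a+1,a+2,\dots\}$, $\mathbb{N}^a=\{\dots,a-2,a-1,a\}$, $\mathbb{N}_a^b=\{a,a+1,\dots,b\}$; $\rho(s)=s-1$. The generalized rising function is $k^{\overline{\gamma}}=\Gamma(k+\gamma)/\Gamma(k)$, and the nabla fractional Taylor monomial of order $\gamma$ ($\gamma$ not a negative integer) is $H_\gamma(k,a)=\dfrac{(k-a)^{\overline{\gamma}}}{\Gamma(\gamma+1)}$. For $0<\alpha<1$ and a vector- or matrix-valued function $z$ on $\mathbb{N}_{a+1}$, the nabla Riemann-Liouville fractional difference is $$\nabla_a^{\alpha}z(k)=\sum_{s=a+1}^{k}H_{-\alpha-1}(k,\rho(s))\,z(s),\quad k\in\mathbb{N}_{a+1}.$$ The nabla Mittag-Leffler function is $\mathbb{E}_{M,\alpha,\gamma}(k,a)=\sum_{i=0}^{\infty}M^iH_{i\alpha+\gamma}(k,a)$.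 Let $\Theta$ and $I$ be the zero and identity $n\times n$ matrices. The matrices $Q(i,j)$ are defined by $Q(0,j)=\Theta$ for $j\ge0$, $Q(i,-1)=\Theta$ for $i\ge0$, $Q(1,0)=I$, $Q(1,j)=\Theta$ for $j\ge1$, and $Q(i+1,j)=MQ(i,j)+NQ(i,j-1)$ for $i\ge1$, $j\ge0$. The discrete delayed perturbation of the Mittag-Leffler matrix function is defined for integers $k$ by $$\mathbb{D}_{\alpha,\beta,r}^{M,N}(k)=\begin{cases}\Theta,& k\in\mathbb{N}^{-r-1},\\ I,& k=-r,\\ \sum_{i=0}^{\infty}M^iH_{i\alpha+\beta-1}(k,-r),& k\in\mathbb{N}_{1-r}^{0},\\ \sum_{i=0}^{\infty}\sum_{j=0}^{p}Q(i+1,j)\,H_{i\alpha+\beta-1}(k,(j-1)r),& k\in\mathbb{N}_{(p-1)r+1}^{pr},\ p\in\mathbb{N}_1.\end{cases}$$ The infinite series in these definitions are presupposed to converge, so that the functions are well defined. *)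

theory Defs
  imports "HOL-Analysis.Analysis"
begin

text \<open>
  The library's \<open>Gamma\<close> is \<open>0\<close> at its poles and division by zero gives \<open>0\<close>; for
  \<open>0 < \<alpha> < 1\<close> and \<open>\<beta> = \<alpha>\<close>, none of the \<open>Gamma\<close> values entering the functions
  below on their domains is taken at a pole.
\<close>

definition gen_rising :: "real \<Rightarrow> real \<Rightarrow> real" where
  "gen_rising k \<gamma> = Gamma (k + \<gamma>) / Gamma k"

definition taylor_monomial :: "real \<Rightarrow> real \<Rightarrow> real \<Rightarrow> real" where
  "taylor_monomial \<gamma> k a = gen_rising (k - a) \<gamma> / Gamma (\<gamma> + 1)"

text \<open>The base point is taken to be an integer, so that the grid is a set of integers.\<close>

definition nabla_RL :: "real \<Rightarrow> int \<Rightarrow> (int \<Rightarrow> 'v::real_vector) \<Rightarrow> int \<Rightarrow> 'v" where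
  "nabla_RL \<alpha> a z k =
     (\<Sum>s = a + 1..k. taylor_monomial (- \<alpha> - 1) (of_int k) (of_int (s - 1)) *\<^sub>R z s)"

text \<open>The power operation \<open>M ^ i\<close> of the library is componentwise on \<open>real ^ 'n ^ 'n\<close>.\<close>

primrec matpow :: "real ^ 'n ^ 'n \<Rightarrow> nat \<Rightarrow> real ^ 'n ^ 'n" where
  "matpow M 0 = mat 1"
| "matpow M (Suc i) = M ** matpow M i"

definition mittag_leffler ::
    "real ^ 'n ^ 'n \<Rightarrow> real \<Rightarrow> real \<Rightarrow> real \<Rightarrow> real \<Rightarrow> real ^ 'n ^ 'n" where
  "mittag_leffler M \<alpha> \<gamma> k a =
     (\<Sum>i. taylor_monomial (real i * \<alpha> + \<gamma>) k a *\<^sub>R matpow M i)"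

text \<open>The second index is an integer since \<open>j = -1\<close> occurs; all \<open>j < 0\<close> give \<open>0\<close>.\<close>

fun delayQ :: "real ^ 'n ^ 'n \<Rightarrow> real ^ 'n ^ 'n \<Rightarrow> nat \<Rightarrow> int \<Rightarrow> real ^ 'n ^ 'n" where
  "delayQ M N 0 j = 0"
| "delayQ M N (Suc 0) j = (if j = 0 then mat 1 else 0)"
| "delayQ M N (Suc (Suc i)) j =
     (if j < 0 then 0
      else M ** delayQ M N (Suc i) j + N ** delayQ M N (Suc i) (j - 1))"

definition delay_block :: "int \<Rightarrow> int \<Rightarrow> int" where
  "delay_block r k = (THE p. p \<ge> 1 \<and> (p - 1) * r + 1 \<le> k \<and> k \<le> p * r)"

lemma delay_block_eqI:
  assumes "p \<ge> 1" "(p - 1) * r + 1 \<le> k" "k \<le> p * r"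
  shows "delay_block r k = p"
  unfolding delay_block_def
proof (rule the_equality)
  fix q assume q: "q \<ge> 1 \<and> (q - 1) * r + 1 \<le> k \<and> k \<le> q * r"
  have "r > 0" using assms by (simp add: algebra_simps)
  have "(q - 1) * r < p * r" "(p - 1) * r < q * r" using q assms by linarith+
  then have "q - 1 < p" "p - 1 < q" using \<open>r > 0\<close> by (simp_all only: mult_less_cancel_right_pos)
  then show "q = p" by linarith
qed (use assms in auto)

definition series_term_init ::
    "real \<Rightarrow> real \<Rightarrow> int \<Rightarrow> real ^ 'n ^ 'n \<Rightarrow> int \<Rightarrow> nat \<Rightarrow> real ^ 'n ^ 'n" where
  "series_term_init \<alpha> \<beta> r M k i =
     taylor_monomial (real i * \<alpha> + \<beta> - 1) (of_int k) (of_int (- r)) *\<^sub>R matpow M i"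

definition series_term_block ::
    "real \<Rightarrow> real \<Rightarrow> int \<Rightarrow> real ^ 'n ^ 'n \<Rightarrow> real ^ 'n ^ 'n \<Rightarrow> int \<Rightarrow> nat \<Rightarrow> real ^ 'n ^ 'n" where
  "series_term_block \<alpha> \<beta> r M N k i =
     (\<Sum>j = 0..delay_block r k.
        taylor_monomial (real i * \<alpha> + \<beta> - 1) (of_int k) (of_int ((j - 1) * r))
          *\<^sub>R delayQ M N (i + 1) j)"

definition delayed_ML ::
    "real \<Rightarrow> real \<Rightarrow> int \<Rightarrow> real ^ 'n ^ 'n \<Rightarrow> real ^ 'n ^ 'n \<Rightarrow> int \<Rightarrow> real ^ 'n ^ 'n" where
  "delayed_ML \<alpha> \<beta> r M N k =
     (if k \<le> - r - 1 then 0
      else if k = - r then mat 1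
      else if k \<le> 0 then (\<Sum>i. series_term_init \<alpha> \<beta> r M k i)
      else (\<Sum>i. series_term_block \<alpha> \<beta> r M N k i))"

text \<open>
  Well-definedness of \<open>delayed_ML\<close>: \<open>suminf\<close> is meaningful only for convergent series.
\<close>

definition delayed_ML_converges ::
    "real \<Rightarrow> real \<Rightarrow> int \<Rightarrow> real ^ 'n ^ 'n \<Rightarrow> real ^ 'n ^ 'n \<Rightarrow> bool" where
  "delayed_ML_converges \<alpha> \<beta> r M N \<longleftrightarrow>
     (\<forall>k\<in>{1 - r..0}. summable (series_term_init \<alpha> \<beta> r M k)) \<and>
     (\<forall>k\<ge>1. summable (series_term_block \<alpha> \<beta> r M N k))"

end

theory Submission
  imports Defs
begin

text \<open>
  On the integer grid, \<open>H\<^bsub>c-1\<^esub>(k, a)\<close> is the coefficient of \<open>x ^ (k - a - 1)\<close> in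
  \<open>(1 - x) powr (-c)\<close>. The Riemann-Liouville difference is therefore multiplication of generating
  functions by \<open>(1 - x) powr \<alpha>\<close>, which turns \<open>H\<^bsub>(i+1)\<alpha>-1\<^esub>\<close> into \<open>H\<^bsub>i\<alpha>-1\<^esub>\<close>. As these coefficients
  vanish for \<open>k \<le> a\<close>, the sum over \<open>j\<close> in the series for \<open>z(k)\<close> may be extended to any common upper
  bound, and the equation follows termwise from the recursion for \<open>Q(i+1, j)\<close>.
\<close>

text \<open>Pochhammer symbols keep the coefficient meaningful at \<open>c = 0\<close>, where it
  belongs to the constant series 1; a Gamma quotient would there divide by \<open>Gamma c\<close> at
  a pole.\<close>

definition rising_coeff :: "real \<Rightarrow> int \<Rightarrow> real" where
  "rising_coeff c m = (if m \<ge> 1 then pochhammer c (nat (m - 1)) / fact (nat (m - 1)) else 0)"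

lemma rising_coeff_Suc [simp]: "rising_coeff c (int n + 1) = pochhammer c n / fact n"
  by (simp add: rising_coeff_def)

lemma rising_coeff_nonpos [simp]: "m \<le> 0 \<Longrightarrow> rising_coeff c m = 0"
  by (simp add: rising_coeff_def)

lemma rising_coeff_0: "m \<ge> 2 \<Longrightarrow> rising_coeff 0 m = 0"
  by (simp add: rising_coeff_def pochhammer_0_left)

lemma taylor_monomial_eq_rising_coeff:
  assumes "\<gamma> + 1 \<notin> \<int>\<^sub>\<le>\<^sub>0"
  shows "taylor_monomial \<gamma> (of_int k) (of_int a) = rising_coeff (\<gamma> + 1) (k - a)"
proof (cases "k \<le> a")
  case True
  \<comment> \<open>At this pole \<open>Gamma\<close> is 0, and dividing by it returns 0, which
    agrees with \<open>rising_coeff\<close>.\<close>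
  then have "real_of_int (k - a) \<in> \<int>\<^sub>\<le>\<^sub>0" by (metis diff_le_0_iff_le nonpos_Ints_of_int)
  then show ?thesis using True by (simp add: taylor_monomial_def gen_rising_def Gamma_eq_zero_iff)
next
  case False
  define n where "n = nat (k - a - 1)"
  have n: "k - a = int n + 1" using False by (simp add: n_def)
  then have nr: "real_of_int k - real_of_int a = 1 + real n"
    by (metis add.commute of_int_1 of_int_add of_int_diff of_int_of_nat_eq)
  show ?thesis
    unfolding n taylor_monomial_def gen_rising_def nr rising_coeff_Suc
    using assms by (simp add: Gamma_fact pochhammer_Gamma add_ac)
qed

text \<open>Chu-Vandermonde: the powers -c and -d of 1 - x multiply to the power -(c + d). Summation
  may start from any b \<le> a since the second factor vanishes for s \<le> a; so the single base
  point -r can serve all delays.\<close>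

lemma rising_coeff_convolution:
  assumes "b \<le> a"
  shows "(\<Sum>s = b + 1..k. rising_coeff c (k - s + 1) * rising_coeff d (s - a))
           = rising_coeff (c + d) (k - a)"
proof (cases "k \<le> a")
  case True
  then show ?thesis by (auto intro!: sum.neutral)
next
  case False
  define n where "n = nat (k - a - 1)"
  have k: "k = a + int n + 1" using False by (simp add: n_def)
  have "(\<Sum>s = b + 1..k. rising_coeff c (k - s + 1) * rising_coeff d (s - a))
      = (\<Sum>s = a + 1..k. rising_coeff c (k - s + 1) * rising_coeff d (s - a))"
    using assms by (intro sum.mono_neutral_right) auto
  also have "\<dots> = (\<Sum>i\<le>n. (pochhammer c i / fact i) * (pochhammer d (n - i) / fact (n - i)))"
  proof (rule sum.reindex_bij_witness[where i = "\<lambda>i. k - int i" and j = "\<lambda>s. nat (k - s)"])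
    fix s assume s: "s \<in> {a + 1..k}"
    then have "k - s + 1 = int (nat (k - s)) + 1" "s - a = int (n - nat (k - s)) + 1"
      by (auto simp: k)
    then show "pochhammer c (nat (k - s)) / fact (nat (k - s)) *
        (pochhammer d (n - nat (k - s)) / fact (n - nat (k - s)))
        = rising_coeff c (k - s + 1) * rising_coeff d (s - a)"
      by (simp only: rising_coeff_Suc)
  qed (auto simp: k)
  \<comment> \<open>The binomial theorem for rising factorials, divided by
    \<open>fact n\<close>.\<close>
  also have "\<dots> = pochhammer (c + d) n / fact n"
    unfolding pochhammer_binomial_sum sum_divide_distrib
    by (intro sum.cong refl) (simp add: binomial_fact field_simps)
  also have "\<dots> = rising_coeff (c + d) (k - a)" by (simp add: k)
  finally show ?thesis .
qed

lemma bounded_linear_matrix_mult_left: "bounded_linear ((**) (A :: real ^ 'n ^ 'm) :: real ^ 'k ^ 'n \<Rightarrow> real ^ 'k ^ 'm)"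
  unfolding linear_conv_bounded_linear[symmetric]
  by (intro linearI) (simp_all add: vec_eq_iff matrix_matrix_mult_def
        distrib_left sum.distrib sum_distrib_left mult_ac)

lemma delayQ_neg: "j < 0 \<Longrightarrow> delayQ M N i j = 0"
  by (induction M N i j rule: delayQ.induct) auto

text \<open>For j = 0 the N-part of the recursion meets index -1, where Q vanishes. This identifies
  the initial series with the j = 0 part of the delayed one.\<close>

lemma delayQ_Suc_0: "delayQ M N (Suc i) 0 = matpow M i"
  by (induction i) (simp_all add: delayQ_neg vec_eq_iff matrix_matrix_mult_def)

text \<open>A parameter J replaces \<open>delay_block r k\<close>: under the Riemann-Liouville sum
  the block varies with s, whereas a fixed bound lets the sums over s and j be exchanged.\<close>

definition delay_term ::
    "real \<Rightarrow> int \<Rightarrow> real ^ 'n ^ 'n \<Rightarrow> real ^ 'n ^ 'n \<Rightarrow> int \<Rightarrow> int \<Rightarrow> nat \<Rightarrow> real ^ 'n ^ 'n" where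
  "delay_term \<alpha> r M N J k i =
     (\<Sum>j = 0..J. rising_coeff (real (Suc i) * \<alpha>) (k - (j - 1) * r) *\<^sub>R delayQ M N (Suc i) j)"

text \<open>For j > p the base point (j - 1) r is at least p r \<ge> k, so the coefficient
  vanishes.\<close>

lemma delay_term_truncate:
  assumes "r \<ge> 0" "k \<le> p * r" "p \<le> J"
  shows "delay_term \<alpha> r M N J k = delay_term \<alpha> r M N p k"
proof
  fix i
  have "k - (j - 1) * r \<le> 0" if "j > p" for j
    using mult_right_mono[of p "j - 1" r] that assms by linarith
  then show "delay_term \<alpha> r M N J k i = delay_term \<alpha> r M N p k i"
    unfolding delay_term_def using assms by (intro sum.mono_neutral_right) auto
qed

lemma taylor_monomial_order:
  assumes "\<alpha> > 0"
  shows "taylor_monomial (real i * \<alpha> + \<alpha> - 1) (of_int k) (of_int a)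
           = rising_coeff (real (Suc i) * \<alpha>) (k - a)"
proof -
  have "real i * \<alpha> + \<alpha> > 0" using assms by (simp add: add_nonneg_pos)
  then have "real i * \<alpha> + \<alpha> \<notin> \<int>\<^sub>\<le>\<^sub>0" by (auto elim!: nonpos_Ints_cases)
  then show ?thesis
    using taylor_monomial_eq_rising_coeff[of "real i * \<alpha> + \<alpha> - 1"]
    by (simp add: algebra_simps)
qed

text \<open>The initial interval acts as block 0. The range stops short of k = -r, where all
  coefficients vanish but \<open>delayed_ML\<close> is \<open>mat 1\<close>.\<close>

lemma delay_term_sums:
  assumes "\<alpha> > 0" "r \<ge> 1" and conv: "delayed_ML_converges \<alpha> \<alpha> r M N"
    and "k \<ge> 1 - r" "J \<ge> 0" "k \<le> J * r"
  shows "delay_term \<alpha> r M N J k sums delayed_ML \<alpha> \<alpha> r M N k"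
proof (cases "k \<le> 0")
  case True
  have "delay_term \<alpha> r M N J k = series_term_init \<alpha> \<alpha> r M k"
    using delay_term_truncate[of r k 0 J] True assms
      taylor_monomial_order[OF \<open>\<alpha> > 0\<close>, of _ k "- r"]
    by (auto simp: delay_term_def series_term_init_def delayQ_Suc_0 fun_eq_iff)
  moreover have "summable (series_term_init \<alpha> \<alpha> r M k)"
    using conv True assms by (simp add: delayed_ML_converges_def)
  ultimately show ?thesis
    using True assms by (simp add: delayed_ML_def summable_sums)
next
  case False
  \<comment> \<open>Block p ends at p r inclusive, hence the division of k - 1 rather than
    k.\<close>
  define p where "p = (k - 1) div r + 1"
  have "(p - 1) * r + (k - 1) mod r = k - 1" by (simp add: p_def)
  moreover have "0 \<le> (k - 1) mod r" "(k - 1) mod r < r" using assms by simp_all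
  ultimately have lo: "(p - 1) * r + 1 \<le> k" and hi: "k \<le> p * r" by (simp_all add: left_diff_distrib)
  have "p \<ge> 1" using False assms by (simp add: p_def pos_imp_zdiv_nonneg_iff)
  then have p: "delay_block r k = p" using lo hi by (intro delay_block_eqI)
  have "p - 1 < J"
    using lo \<open>k \<le> J * r\<close> \<open>r \<ge> 1\<close> mult_right_mono[of J "p - 1" r] by linarith
  then have "delay_term \<alpha> r M N J k = delay_term \<alpha> r M N p k"
    using hi assms by (intro delay_term_truncate) auto
  also have "\<dots> = series_term_block \<alpha> \<alpha> r M N k"
    using taylor_monomial_order[OF \<open>\<alpha> > 0\<close>, of _ k "(j - 1) * r" for j]
    by (auto simp: delay_term_def series_term_block_def p fun_eq_iff simp del: of_int_mult)
  finally have "delay_term \<alpha> r M N J k = series_term_block \<alpha> \<alpha> r M N k" .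
  moreover have "summable (series_term_block \<alpha> \<alpha> r M N k)"
    using conv False by (simp add: delayed_ML_converges_def)
  ultimately show ?thesis
    using False assms by (simp add: delayed_ML_def summable_sums)
qed

text \<open>For each j separately, convolution with order -\<alpha> lowers the order (i + 1)
  \<alpha> to i \<alpha> and keeps the base point.\<close>

lemma nabla_RL_delay_term:
  assumes "0 < \<alpha>" "\<alpha> < 1" "r \<ge> 0"
  shows "nabla_RL \<alpha> (- r) (\<lambda>s. delay_term \<alpha> r M N J s i) k
           = (\<Sum>j = 0..J. rising_coeff (real i * \<alpha>) (k - (j - 1) * r) *\<^sub>R delayQ M N (Suc i) j)"
proof -
  have "- \<alpha> \<notin> \<int>\<^sub>\<le>\<^sub>0"
  proof
    assume "- \<alpha> \<in> \<int>\<^sub>\<le>\<^sub>0"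
    then obtain n where "- \<alpha> = of_int n" by (elim nonpos_Ints_cases)
    then have "n < 0" "- 1 < n" using assms by linarith+
    then show False by simp
  qed
  then have H: "taylor_monomial (- \<alpha> - 1) (of_int k) (of_int (s - 1)) = rising_coeff (- \<alpha>) (k - s + 1)"
    for s using taylor_monomial_eq_rising_coeff[of "- \<alpha> - 1" k "s - 1"] by (simp add: algebra_simps)
  have "nabla_RL \<alpha> (- r) (\<lambda>s. delay_term \<alpha> r M N J s i) k =
     (\<Sum>j = 0..J. (\<Sum>s = - r + 1..k. rising_coeff (- \<alpha>) (k - s + 1) *
        rising_coeff (real (Suc i) * \<alpha>) (s - (j - 1) * r)) *\<^sub>R delayQ M N (Suc i) j)"
    unfolding nabla_RL_def H delay_term_def scaleR_sum_right scaleR_sum_left scaleR_scaleR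
    by (rule sum.swap)
  also have "\<dots> = (\<Sum>j = 0..J.
      rising_coeff (- \<alpha> + real (Suc i) * \<alpha>) (k - (j - 1) * r) *\<^sub>R delayQ M N (Suc i) j)"
  proof (intro sum.cong refl)
    fix j assume "j \<in> {0..J}"
    \<comment> \<open>No base point lies left of -r, as the convolution identity requires.\<close>
    then have "- r \<le> (j - 1) * r" using mult_right_mono[of "-1" "j - 1" r] assms by simp
    then show "(\<Sum>s = - r + 1..k. rising_coeff (- \<alpha>) (k - s + 1) *
        rising_coeff (real (Suc i) * \<alpha>) (s - (j - 1) * r)) *\<^sub>R delayQ M N (Suc i) j
      = rising_coeff (- \<alpha> + real (Suc i) * \<alpha>) (k - (j - 1) * r) *\<^sub>R delayQ M N (Suc i) j"
      by (simp only: rising_coeff_convolution)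
  qed
  also have "- \<alpha> + real (Suc i) * \<alpha> = real i * \<alpha>" by (simp add: algebra_simps)
  finally show ?thesis .
qed

text \<open>Q(1, j) leaves only j = 0, with the coefficient of order 0 at k + r \<ge> 2, which is
  zero.\<close>

lemma nabla_RL_delay_term_0:
  assumes "0 < \<alpha>" "\<alpha> < 1" "r \<ge> 1" "k \<ge> 1"
  shows "nabla_RL \<alpha> (- r) (\<lambda>s. delay_term \<alpha> r M N J s 0) k = 0"
  using assms by (auto simp: nabla_RL_delay_term rising_coeff_0 intro!: sum.neutral)

text \<open>In the N-part of the recursion for Q, replacing j by j + 1 moves the base point by r,
  which amounts to evaluating at k - r.\<close>

lemma nabla_RL_delay_term_Suc:
  assumes "0 < \<alpha>" "\<alpha> < 1" "r \<ge> 0" "k \<le> J * r"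
  shows "nabla_RL \<alpha> (- r) (\<lambda>s. delay_term \<alpha> r M N J s (Suc i)) k
           = M ** delay_term \<alpha> r M N J k i + N ** delay_term \<alpha> r M N J (k - r) i"
proof -
  interpret M: bounded_linear "(**) M" by (rule bounded_linear_matrix_mult_left)
  interpret N: bounded_linear "(**) N" by (rule bounded_linear_matrix_mult_left)
  let ?c = "\<lambda>j. rising_coeff (real (Suc i) * \<alpha>) (k - (j - 1) * r)"
  let ?Q = "delayQ M N (Suc i)"
  have "(\<Sum>j = 0..J. ?c j *\<^sub>R ?Q (j - 1)) = (\<Sum>j = -1..J - 1. ?c (j + 1) *\<^sub>R ?Q j)"
    by (rule sum.reindex_bij_witness[where i = "\<lambda>j. j + 1" and j = "\<lambda>j. j - 1"]) auto
  \<comment> \<open>The added term j = J has its coefficient at k - J r \<le> 0.\<close>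
  also have "\<dots> = (\<Sum>j = -1..J. ?c (j + 1) *\<^sub>R ?Q j)"
  proof (intro sum.mono_neutral_left)
    show "\<forall>j\<in>{-1..J} - {-1..J - 1}. ?c (j + 1) *\<^sub>R ?Q j = 0"
    proof
      fix j assume "j \<in> {-1..J} - {-1..J - 1}"
      then have "j = J" by auto
      then show "?c (j + 1) *\<^sub>R ?Q j = 0" using assms(4) by simp
    qed
  qed auto
  also have "\<dots> = (\<Sum>j = 0..J. ?c (j + 1) *\<^sub>R ?Q j)"
    by (intro sum.mono_neutral_right) (auto simp: delayQ_neg)
  also have "\<dots> = delay_term \<alpha> r M N J (k - r) i"
    by (simp add: delay_term_def algebra_simps)
  finally have shift: "(\<Sum>j = 0..J. ?c j *\<^sub>R ?Q (j - 1)) = delay_term \<alpha> r M N J (k - r) i" .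
  have "nabla_RL \<alpha> (- r) (\<lambda>s. delay_term \<alpha> r M N J s (Suc i)) k
      = (\<Sum>j = 0..J. ?c j *\<^sub>R (M ** ?Q j + N ** ?Q (j - 1)))"
    using assms by (simp add: nabla_RL_delay_term)
  also have "\<dots> = M ** delay_term \<alpha> r M N J k i + N ** (\<Sum>j = 0..J. ?c j *\<^sub>R ?Q (j - 1))"
    by (simp only: delay_term_def scaleR_add_right sum.distrib M.sum N.sum M.scaleR N.scaleR)
  finally show ?thesis by (simp only: shift)
qed

text \<open>At fixed k the difference is a finite linear combination of values, so it passes through
  convergent series.\<close>

lemma nabla_RL_sums:
  fixes f :: "int \<Rightarrow> nat \<Rightarrow> 'v::real_normed_vector"
  assumes "\<And>s. a < s \<Longrightarrow> s \<le> k \<Longrightarrow> f s sums z s"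
  shows "(\<lambda>i. nabla_RL \<alpha> a (\<lambda>s. f s i) k) sums nabla_RL \<alpha> a z k"
  unfolding nabla_RL_def using assms by (intro sums_sum sums_scaleR_right) auto

theorem theorem14:
  fixes M N :: "real ^ 'n ^ 'n" and \<alpha> :: real and r :: int
  assumes "0 < \<alpha>" and "\<alpha> < 1" and "r \<ge> 2"
    and "delayed_ML_converges \<alpha> \<alpha> r M N"
  shows "(\<forall>k\<ge>1. nabla_RL \<alpha> (- r) (delayed_ML \<alpha> \<alpha> r M N) k =
            M ** delayed_ML \<alpha> \<alpha> r M N k + N ** delayed_ML \<alpha> \<alpha> r M N (k - r)) \<and>
         (\<forall>k\<in>{1 - r..0}. delayed_ML \<alpha> \<alpha> r M N k =
            mittag_leffler M \<alpha> (\<alpha> - 1) (of_int k) (of_int (- r)))"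
proof (intro conjI allI ballI impI)
  fix k :: int assume k: "k \<ge> 1"
  let ?z = "delayed_ML \<alpha> \<alpha> r M N" and ?t = "delay_term \<alpha> r M N k"
  \<comment> \<open>The choice J = k bounds the block of every s \<le> k.\<close>
  have le: "k \<le> k * r" using k assms(3) by simp
  have t: "?t s sums ?z s" if "1 - r \<le> s" "s \<le> k" for s
    using that k order_trans[OF that(2) le] assms by (intro delay_term_sums) auto
  have "(\<lambda>i. nabla_RL \<alpha> (- r) (\<lambda>s. ?t s i) k) sums nabla_RL \<alpha> (- r) ?z k"
    using t by (intro nabla_RL_sums) auto
  \<comment> \<open>The term i = 0 is zero; dropping it aligns the index with the recursion for
    Q.\<close>
  then have "(\<lambda>i. nabla_RL \<alpha> (- r) (\<lambda>s. ?t s (Suc i)) k) sums nabla_RL \<alpha> (- r) ?z k"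
    using k assms
    by (subst sums_Suc_iff[where f = "\<lambda>i. nabla_RL \<alpha> (- r) (\<lambda>s. ?t s i) k"])
       (simp add: nabla_RL_delay_term_0)
  then have "(\<lambda>i. M ** ?t k i + N ** ?t (k - r) i) sums nabla_RL \<alpha> (- r) ?z k"
    using le assms by (simp add: nabla_RL_delay_term_Suc)
  moreover have "(\<lambda>i. M ** ?t k i + N ** ?t (k - r) i) sums (M ** ?z k + N ** ?z (k - r))"
    using k assms(3)
    by (intro sums_add bounded_linear.sums[OF bounded_linear_matrix_mult_left] t) auto
  ultimately show "nabla_RL \<alpha> (- r) ?z k = M ** ?z k + N ** ?z (k - r)"
    by (rule sums_unique2)
next
  fix k assume "k \<in> {1 - r..0}"
  then show "delayed_ML \<alpha> \<alpha> r M N k = mittag_leffler M \<alpha> (\<alpha> - 1) (of_int k) (of_int (- r))"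
    by (simp add: delayed_ML_def mittag_leffler_def series_term_init_def[abs_def] add_diff_eq)
qed

end
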